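(* Let $Y'$ be a subscheme of a projective space, let $Y$ be a Cartier divisor in $Y'$, let $r\ge 0$ and $t\ge 1$ be integers, and suppose that $Y$ is in the linear system $|\mathcal{O}_{Y'}(t)|$. Then any strong $r$-plane in $Y$ (with respect to $Y'$) is the support of a $t$-fat $r$-plane contained in $Y$. Conversely, if furthermore $Y'$ is (set-theoretically) defined by equations of degree strictly less than $t$, then the support of any $t$-fat $r$-plane contained in $Y$ is strong.
   Context: The base field is algebraically closed of characteristic zero. A $t$-fat $r$-plane in a projective space is the $t$-th infinitesimal neighborhood of an $r$-plane in an $(r+1)$-plane, i.e. the subscheme of an $(r+1)$-plane $L'$ defined by $x_0^t=0$, where $x_0=0$ is the equation in $L'$ of an $r$-plane; that $r$-plane is its support. An $r$-plane $L$ contained in $Y$ is called strong (with respect to $Y'$) if there exists an $(r+1)$-plane $L'$ contained in $Y'$ and containing $L$ such that the set-theoretic intersection $L'\cap Y$ is either $L$ or $L'$.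
   Formalization: Y' is closed, and the equations of degree less than t that set-theoretically define Y' are required to vanish on the scheme Y' (automatic if Y' is reduced); otherwise the converse fails, e.g. for Y' a double line x²=0 in the plane, t=2 and Y cut out by yz=0. *)

theory Defs
  imports
    "HOL-Analysis.Analysis"
    "HOL-Library.Poly_Mapping"
    "HOL-Computational_Algebra.Computational_Algebra"
begin

text \<open>
  The homogeneous coordinate ring of the projective space \<open>\<P>\<^sup>n\<close> over \<open>'k\<close> is
  \<open>S = k[X\<^sub>v | v :: 'v]\<close>, where \<open>CARD('v) = n + 1\<close>. A closed subscheme of \<open>\<P>\<^sup>n\<close> is
  represented by its saturated homogeneous ideal in \<open>S\<close>. Inclusion of subschemes is therefore
  reverse inclusion of ideals.
\<close>

type_synonym ('v, 'k) mpoly = "('v \<Rightarrow>\<^sub>0 nat) \<Rightarrow>\<^sub>0 'k"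

global_interpretation ideal: module "(*) :: 'a::comm_ring_1 \<Rightarrow> 'a \<Rightarrow> 'a"
  by standard (simp_all add: algebra_simps)

definition X :: "'v \<Rightarrow> ('v, 'k::comm_ring_1) mpoly" where
  "X v = Poly_Mapping.single (Poly_Mapping.single v 1) 1"

definition linear_form :: "'k^'v::finite \<Rightarrow> ('v, 'k::comm_ring_1) mpoly" where
  "linear_form c = (\<Sum>v\<in>UNIV. Poly_Mapping.single (Poly_Mapping.single v 1) (c $ v))"

definition homogeneous :: "nat \<Rightarrow> ('v::finite, 'k::comm_ring_1) mpoly \<Rightarrow> bool" where
  "homogeneous d p \<longleftrightarrow>
     (\<forall>m \<in> Poly_Mapping.keys p. (\<Sum>v\<in>UNIV. Poly_Mapping.lookup m v) = d)"

definition homogeneous_ideal :: "('v::finite, 'k::comm_ring_1) mpoly set \<Rightarrow> bool" where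
  "homogeneous_ideal I \<longleftrightarrow>
     ideal.subspace I \<and> ideal.span {p \<in> I. \<exists>d. homogeneous d p} = I"

text \<open>
  \<open>on_chart f I\<close> is the contraction to \<open>S\<close> of the extension of \<open>I\<close> to the localization
  \<open>S\<^sub>f\<close>. Two homogeneous ideals define the same subscheme of the open set \<open>D\<^sub>+(f)\<close> when (and, if
  \<open>f\<close> is homogeneous and divisible by some \<open>X\<^sub>v\<close>, only when) these contractions agree: in that
  case \<open>S\<^sub>f\<close> is the ring of Laurent polynomials in \<open>X\<^sub>v\<close> over its degree zero part.
\<close>

definition on_chart :: "'a::comm_ring_1 \<Rightarrow> 'a set \<Rightarrow> 'a set" where
  "on_chart f I = {p. \<exists>M::nat. f ^ M * p \<in> I}"

definition closed_subscheme :: "('v::finite, 'k::comm_ring_1) mpoly set \<Rightarrow> bool" where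
  "closed_subscheme I \<longleftrightarrow> homogeneous_ideal I \<and> (\<Inter>v. on_chart (X v) I) \<subseteq> I"

definition contained_in ::
    "('v::finite, 'k::comm_ring_1) mpoly set \<Rightarrow> ('v, 'k) mpoly set \<Rightarrow> bool" where
  "contained_in Z Y \<longleftrightarrow> Y \<subseteq> Z"

text \<open>
  The underlying set of \<open>Proj (S/I)\<close>: the homogeneous primes that contain \<open>I\<close> but not all the
  variables. The argument may be any set of polynomials, and then the result is the set of
  points of \<open>\<P>\<^sup>n\<close> where all of them vanish.
\<close>

definition homogeneous_prime :: "('v::finite, 'k::comm_ring_1) mpoly set \<Rightarrow> bool" where
  "homogeneous_prime P \<longleftrightarrow>
     homogeneous_ideal P \<and> 1 \<notin> P \<and> (\<forall>p q. p * q \<in> P \<longrightarrow> p \<in> P \<or> q \<in> P)"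

definition points :: "('v::finite, 'k::comm_ring_1) mpoly set \<Rightarrow> ('v, 'k) mpoly set set" where
  "points I = {P. homogeneous_prime P \<and> I \<subseteq> P \<and> (\<exists>v. X v \<notin> P)}"

text \<open>
  The equations belong to the ideal of \<open>Y\<close>; only the scheme structure they define may be larger.
\<close>

definition set_theoretically_defined_in_degree_less ::
    "nat \<Rightarrow> ('v::finite, 'k::comm_ring_1) mpoly set \<Rightarrow> bool" where
  "set_theoretically_defined_in_degree_less t Y \<longleftrightarrow>
     (\<exists>F \<subseteq> Y. (\<forall>f\<in>F. \<exists>d<t. homogeneous d f) \<and> points F = points Y)"

text \<open>
  Effective Cartier divisors: around each point of \<open>Y'\<close> the subscheme \<open>Y\<close> is cut out in \<open>Y'\<close> by
  one equation \<open>g\<close> that is not a zero divisor on \<open>Y'\<close>. The neighbourhood \<open>D\<^sub>+(f)\<close> can always be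
  shrunk to one where \<open>f\<close> is divisible by a variable; there \<open>g\<close> is, up to a unit, of degree zero.
\<close>

definition cartier_divisor ::
    "('v::finite, 'k::comm_ring_1) mpoly set \<Rightarrow> ('v, 'k) mpoly set \<Rightarrow> bool" where
  "cartier_divisor Y' Y \<longleftrightarrow>
     closed_subscheme Y \<and> contained_in Y Y' \<and>
     (\<forall>P \<in> points Y'. \<exists>f g.
        (\<exists>d. homogeneous d f) \<and> f \<notin> P \<and> (\<exists>e. homogeneous e g) \<and>
        on_chart f Y = on_chart f (ideal.span (insert g Y')) \<and>
        (\<forall>p. g * p \<in> on_chart f Y' \<longrightarrow> p \<in> on_chart f Y'))"

text \<open>
  A global section of \<open>\<O>\<^bsub>Y'\<^esub>(t)\<close> is given by fractions \<open>g\<^sub>v / X\<^sub>v\<^sup>N\<close> of degree \<open>t\<close> in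
  \<open>(S/I)\<^bsub>X\<^sub>v\<^esub>\<close>, where \<open>I\<close> is the ideal of \<open>Y'\<close>, which agree in \<open>(S/I)\<^bsub>X\<^sub>u X\<^sub>v\<^esub>\<close>. As there are
  finitely many charts a common exponent \<open>N\<close> can be used. Such a section need not be the
  restriction of a form of degree \<open>t\<close> on \<open>\<P>\<^sup>n\<close>.
\<close>

definition is_section ::
    "('v::finite, 'k::comm_ring_1) mpoly set \<Rightarrow> nat \<Rightarrow> nat \<Rightarrow> ('v \<Rightarrow> ('v, 'k) mpoly) \<Rightarrow> bool" where
  "is_section Y' t N g \<longleftrightarrow>
     (\<forall>v. homogeneous (t + N) (g v)) \<and>
     (\<forall>u v. X v ^ N * g u - X u ^ N * g v \<in> on_chart (X u * X v) Y')"

definition is_zero_scheme ::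
    "('v::finite, 'k::comm_ring_1) mpoly set \<Rightarrow> ('v \<Rightarrow> ('v, 'k) mpoly) \<Rightarrow> ('v, 'k) mpoly set \<Rightarrow> bool"
  where
  "is_zero_scheme Y' g Y \<longleftrightarrow>
     closed_subscheme Y \<and>
     (\<forall>v. on_chart (X v) Y = on_chart (X v) (ideal.span (insert (g v) Y')))"

text \<open>
  The complete linear system of \<open>\<O>\<^bsub>Y'\<^esub>(t)\<close>. That the section is regular (locally not a zero
  divisor) follows from its zero scheme being a Cartier divisor.
\<close>

definition linear_system ::
    "('v::finite, 'k::comm_ring_1) mpoly set \<Rightarrow> nat \<Rightarrow> ('v, 'k) mpoly set set" where
  "linear_system Y' t =
     {Y. cartier_divisor Y' Y \<and> (\<exists>N g. is_section Y' t N g \<and> is_zero_scheme Y' g Y)}"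

text \<open>An \<open>r\<close>-plane in \<open>\<P>\<^sup>n\<close> is cut out by \<open>n - r\<close> independent linear forms.\<close>

definition plane :: "nat \<Rightarrow> ('v::finite, 'k::field) mpoly set \<Rightarrow> bool" where
  "plane r L \<longleftrightarrow>
     (\<exists>V :: ('k^'v) set. vec.subspace V \<and> vec.dim V + (r + 1) = CARD('v) \<and>
        L = ideal.span (linear_form ` V))"

definition fat_plane_with_support ::
    "nat \<Rightarrow> nat \<Rightarrow> ('v::finite, 'k::field) mpoly set \<Rightarrow> ('v, 'k) mpoly set \<Rightarrow> bool" where
  "fat_plane_with_support t r Z L \<longleftrightarrow>
     (\<exists>L' c. plane (r + 1) L' \<and> plane r L \<and>
        L = ideal.span (insert (linear_form c) L') \<and>
        Z = ideal.span (insert (linear_form c ^ t) L'))"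

definition strong_plane ::
    "nat \<Rightarrow> ('v::finite, 'k::field) mpoly set \<Rightarrow> ('v, 'k) mpoly set \<Rightarrow> ('v, 'k) mpoly set \<Rightarrow> bool"
  where
  "strong_plane r Y' Y L \<longleftrightarrow>
     plane r L \<and> contained_in L Y \<and>
     (\<exists>L'. plane (r + 1) L' \<and> contained_in L' Y' \<and> contained_in L L' \<and>
        (points L' \<inter> points Y = points L \<or> points L' \<inter> points Y = points L'))"

end

theory Submission
  imports Defs
begin

text \<open>
  Let \<open>L'\<close> be an \<open>(r + 1)\<close>-plane contained in \<open>Y'\<close>. Its dimension is at least one, so the section of
  \<open>\<O>\<^bsub>Y'\<^esub>(t)\<close> that defines \<open>Y\<close> restricts on \<open>L'\<close> to a form \<open>G\<close> of degree \<open>t\<close>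
  (\<open>section_on_plane_is_form\<close>), and \<open>Y\<close> meets \<open>L'\<close> in the zero scheme of \<open>G\<close>. Let \<open>x\<close> be the
  equation in \<open>L'\<close> of an \<open>r\<close>-plane \<open>L\<close>. Both directions compare \<open>G\<close> with \<open>x\<^sup>t\<close>, which has the same
  degree.

  If \<open>L\<close> is strong, then \<open>G\<close> is zero or vanishes exactly on \<open>L\<close>. Over an algebraically closed field a
  form of degree \<open>t\<close> that vanishes only where \<open>x\<close> does is a constant multiple of \<open>x\<^sup>t\<close>
  (\<open>form_without_zeros_off_hyperplane\<close>), so \<open>Y\<close> contains the fat plane \<open>x\<^sup>t = 0\<close> in \<open>L'\<close>.

  Conversely, let \<open>Y\<close> contain the fat plane \<open>x\<^sup>t = 0\<close> in an \<open>(r + 1)\<close>-plane \<open>L'\<close>. A form of degree less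
  than \<open>t\<close> that is divisible by \<open>x\<^sup>t\<close> on \<open>L'\<close> is zero there (\<open>factor_homogeneous\<close>). This applies to the
  equations of \<open>Y'\<close>, so \<open>L'\<close> is contained in \<open>Y'\<close>. The form \<open>G\<close> is divisible by \<open>x\<^sup>t\<close> as well, and for
  reasons of degree \<open>G\<close> is a constant multiple of \<open>x\<^sup>t\<close>. So \<open>L'\<close> meets \<open>Y\<close> in \<open>L\<close>, or in \<open>L'\<close> if the
  constant is zero.

  The algebra is elementary because the homogeneous ideal of a plane is the ideal of all polynomials
  that vanish on the corresponding linear subspace of \<open>k\<^sup>n\<^sup>+\<^sup>1\<close> (\<open>span_linear_forms\<close>). Congruences modulo
  this ideal can be checked pointwise, or on lines, where polynomials in one variable suffice. It also
  follows that planes have homogeneous prime ideals, which allows cancellation in their coordinate rings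
  (\<open>cancel_modulo_prime\<close>).
\<close>

section \<open>Polynomials as functions\<close>

text \<open>
  For the ring as a module over itself this rewrites \<open>a * (b * x)\<close> to \<open>a * b * x\<close>, and the
  simplifier would loop on it together with \<open>algebra_simps\<close>.
\<close>

declare ideal.scale_scale [simp del]

definition ring_morphism :: "('a::comm_ring_1 \<Rightarrow> 'b::comm_ring_1) \<Rightarrow> bool" where
  "ring_morphism h \<longleftrightarrow>
     h 1 = 1 \<and> (\<forall>x y. h (x + y) = h x + h y) \<and> (\<forall>x y. h (x * y) = h x * h y)"

text \<open>
  The homomorphism that maps coefficients by \<open>h\<close> and the variable \<open>v\<close> to \<open>f v\<close>. With varying target
  it serves for evaluation at a point (target \<open>'k\<close>), for restriction to a line (target \<open>'k poly\<close>) and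
  for a linear change of variables (target \<open>('v, 'k) mpoly\<close>).
\<close>

definition subst ::
    "('k::comm_ring_1 \<Rightarrow> 'a::comm_ring_1) \<Rightarrow> ('v::finite \<Rightarrow> 'a) \<Rightarrow> ('v, 'k) mpoly \<Rightarrow> 'a" where
  "subst h f p = (\<Sum>m\<in>Poly_Mapping.keys p.
     h (Poly_Mapping.lookup p m) * (\<Prod>v\<in>UNIV. f v ^ Poly_Mapping.lookup m v))"

lemma ring_morphism_simps:
  assumes "ring_morphism h"
  shows "h 0 = 0" "h 1 = 1" "h (x + y) = h x + h y" "h (x * y) = h x * h y"
    "h (- x) = - h x" "h (x - y) = h x - h y" "h (x ^ n) = h x ^ n"
    "h (sum g A) = (\<Sum>i\<in>A. h (g i))" "h (prod g A) = (\<Prod>i\<in>A. h (g i))"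
proof -
  have add: "h (x + y) = h x + h y" and mult: "h (x * y) = h x * h y" and one: "h 1 = 1" for x y
    using assms by (auto simp: ring_morphism_def)
  have zero: "h 0 = 0" using add[of 0 0] by simp
  have minus: "h (- x) = - h x" for x
    using add[of x "- x"] zero by (simp add: eq_neg_iff_add_eq_0 add.commute)
  show "h 0 = 0" "h 1 = 1" "h (x + y) = h x + h y" "h (x * y) = h x * h y" "h (- x) = - h x"
    by (fact zero one add mult minus)+
  show "h (x - y) = h x - h y" using add[of x "- y"] minus by simp
  show "h (x ^ n) = h x ^ n" by (induction n) (simp_all add: one mult)
  show "h (sum g A) = (\<Sum>i\<in>A. h (g i))"
    by (induction A rule: infinite_finite_induct) (simp_all add: zero add)
  show "h (prod g A) = (\<Prod>i\<in>A. h (g i))"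
    by (induction A rule: infinite_finite_induct) (simp_all add: one mult)
qed

lemma sum_monomials:
  "(\<Sum>m\<in>Poly_Mapping.keys p. Poly_Mapping.single m (Poly_Mapping.lookup p m)) = p"
  by (rule poly_mapping_eqI)
    (auto simp: lookup_sum lookup_single when_def in_keys_iff)

lemma subst_superset:
  assumes "ring_morphism h" "finite A" "Poly_Mapping.keys p \<subseteq> A"
  shows "subst h f p = (\<Sum>m\<in>A.
     h (Poly_Mapping.lookup p m) * (\<Prod>v\<in>UNIV. f v ^ Poly_Mapping.lookup m v))"
  unfolding subst_def
  by (rule sum.mono_neutral_left)
    (use assms in \<open>auto simp: in_keys_iff ring_morphism_simps[OF assms(1)]\<close>)

lemma subst_single:
  assumes "ring_morphism h"
  shows "subst h f (Poly_Mapping.single m c) =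
     h c * (\<Prod>v\<in>UNIV. f v ^ Poly_Mapping.lookup m v)"
  by (subst subst_superset[where A = "{m}", OF assms]) auto

lemma subst_add:
  assumes "ring_morphism h"
  shows "subst h f (p + q) = subst h f p + subst h f q"
proof -
  let ?A = "Poly_Mapping.keys p \<union> Poly_Mapping.keys q"
  have "Poly_Mapping.keys (p + q) \<subseteq> ?A" by (rule keys_add)
  then show ?thesis
    by (simp add: subst_superset[OF assms, where A = ?A] lookup_add
        ring_morphism_simps[OF assms] sum.distrib distrib_right)
qed

lemma subst_zero [simp]: "subst h f 0 = 0"
  by (simp add: subst_def)

lemma subst_sum:
  assumes "ring_morphism h"
  shows "subst h f (sum g A) = (\<Sum>i\<in>A. subst h f (g i))"
  by (induction A rule: infinite_finite_induct) (simp_all add: subst_add assms)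

lemma ring_morphism_subst:
  assumes "ring_morphism h"
  shows "ring_morphism (subst h f)"
proof -
  have mult: "subst h f (p * q) = subst h f p * subst h f q" for p q
  proof -
    let ?s = "\<lambda>p m. Poly_Mapping.single m (Poly_Mapping.lookup p m)"
    have single: "subst h f (?s p a * ?s q b) = subst h f (?s p a) * subst h f (?s q b)" for a b
      by (simp only: mult_single subst_single[OF assms] ring_morphism_simps(4)[OF assms] lookup_add
          power_add prod.distrib mult_ac)
    have "p * q = (\<Sum>a\<in>Poly_Mapping.keys p. \<Sum>b\<in>Poly_Mapping.keys q. ?s p a * ?s q b)"
      by (simp only: sum_product[symmetric] sum_monomials)
    then have "subst h f (p * q) = (\<Sum>a\<in>Poly_Mapping.keys p. \<Sum>b\<in>Poly_Mapping.keys q.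
        subst h f (?s p a) * subst h f (?s q b))"
      by (simp only: subst_sum[OF assms] single)
    also have "\<dots> = subst h f (\<Sum>a\<in>Poly_Mapping.keys p. ?s p a) *
        subst h f (\<Sum>b\<in>Poly_Mapping.keys q. ?s q b)"
      by (simp only: subst_sum[OF assms] sum_product)
    finally show ?thesis by (simp only: sum_monomials)
  qed
  have "subst h f 1 = 1"
    using subst_single[OF assms, of f 0 1] by (simp add: ring_morphism_simps[OF assms])
  with mult subst_add[OF assms] show ?thesis by (auto simp: ring_morphism_def)
qed

lemma morphism_subst:
  assumes "ring_morphism \<psi>"
  shows "\<psi> (subst h f p) = subst (\<lambda>c. \<psi> (h c)) (\<lambda>v. \<psi> (f v)) p"
  by (simp add: subst_def ring_morphism_simps[OF assms])

lemma subst_X: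
  assumes "ring_morphism h"
  shows "subst h f (X v) = f v"
proof -
  have "(\<Prod>u\<in>UNIV. f u ^ (Poly_Mapping.lookup (Poly_Mapping.single v (1::nat)) u)) =
      (\<Prod>u\<in>UNIV. if v = u then f u else 1)"
    by (rule prod.cong) (auto simp: lookup_single when_def)
  then show ?thesis
    by (simp add: X_def subst_single[OF assms] ring_morphism_simps[OF assms])
qed

lemma linear_form_eq: "linear_form c = (\<Sum>v\<in>UNIV. Poly_Mapping.single 0 (c $ v) * X v)"
  by (simp add: linear_form_def X_def mult_single)

lemma subst_X_self:
  fixes p :: "('v::finite, 'k::comm_ring_1) mpoly"
  shows "subst (Poly_Mapping.single 0) X p = p"
proof -
  have pow: "X v ^ n = Poly_Mapping.single (Poly_Mapping.single v n) (1::'k)" for v :: 'v and n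
    by (induction n) (simp_all add: X_def mult_single flip: single_add)
  have sng: "(\<Prod>v\<in>A. Poly_Mapping.single (g v) 1) = Poly_Mapping.single (sum g A) (1::'k)"
    if "finite A" for g :: "'v \<Rightarrow> 'v \<Rightarrow>\<^sub>0 nat" and A
    using that by induction (simp_all add: mult_single)
  have "(\<Sum>v\<in>UNIV. Poly_Mapping.single v (Poly_Mapping.lookup m v)) = m"
    for m :: "'v \<Rightarrow>\<^sub>0 nat"
    by (rule poly_mapping_eqI) (simp add: lookup_sum lookup_single when_def)
  then show ?thesis
    by (simp add: subst_def pow sng mult_single sum_monomials)
qed

definition eval :: "('v::finite, 'k::comm_ring_1) mpoly \<Rightarrow> 'k^'v \<Rightarrow> 'k" where
  "eval p z = subst (\<lambda>c. c) (\<lambda>v. z $ v) p"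

definition dot :: "'k::comm_ring_1^'v::finite \<Rightarrow> 'k^'v \<Rightarrow> 'k" where
  "dot c z = (\<Sum>v\<in>UNIV. c $ v * z $ v)"

lemma ring_morphism_id: "ring_morphism (\<lambda>c. c)"
  by (simp add: ring_morphism_def)

lemma ring_morphism_eval: "ring_morphism (\<lambda>p. eval p z)"
  unfolding eval_def using ring_morphism_subst[OF ring_morphism_id]
  by (simp add: ring_morphism_def)

lemmas eval_simps [simp] = ring_morphism_simps[OF ring_morphism_eval]

lemma eval_const [simp]: "eval (Poly_Mapping.single 0 c) z = c"
  by (simp add: eval_def subst_single ring_morphism_id)

lemma eval_X [simp]: "eval (X v) z = z $ v"
  by (simp add: eval_def subst_X ring_morphism_id)

lemma eval_linear_form [simp]: "eval (linear_form c) z = dot c z"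
  by (simp add: linear_form_eq dot_def)

lemma eval_subst:
  "eval (subst (Poly_Mapping.single 0) f p) z = eval p (\<chi> v. eval (f v) z)"
  using morphism_subst[OF ring_morphism_eval[of z], of "Poly_Mapping.single 0" f p]
  by (simp add: eval_def[of p])

text \<open>
  Many arguments below restrict a polynomial to a line, where the theory of polynomials in one
  variable applies.
\<close>

lemma eval_on_line:
  fixes p :: "('v::finite, 'k::comm_ring_1) mpoly"
  shows "\<exists>f. \<forall>s. poly f s = eval p (a + s *s b)"
proof -
  have "ring_morphism (\<lambda>f. poly f s)" for s :: 'k
    by (simp add: ring_morphism_def)
  from morphism_subst[OF this, of "\<lambda>c. [:c:]" "\<lambda>v. [:a $ v, b $ v:]" p]
  have "poly (subst (\<lambda>c. [:c:]) (\<lambda>v. [:a $ v, b $ v:]) p) s = eval p (a + s *s b)" for s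
    by (simp add: eval_def algebra_simps)
  then show ?thesis by blast
qed

lemma eval_homogeneous:
  assumes "homogeneous d p"
  shows "eval p (s *s z) = s ^ d * eval p z"
proof -
  have "(\<Prod>v\<in>UNIV. (s *s z) $ v ^ Poly_Mapping.lookup m v) =
      s ^ d * (\<Prod>v\<in>UNIV. z $ v ^ Poly_Mapping.lookup m v)"
    if "m \<in> Poly_Mapping.keys p" for m
  proof -
    have "(\<Sum>v\<in>UNIV. Poly_Mapping.lookup m v) = d"
      using assms that by (auto simp: homogeneous_def)
    then show ?thesis
      by (simp add: power_mult_distrib prod.distrib flip: power_sum)
  qed
  then show ?thesis
    unfolding eval_def subst_def sum_distrib_left
    by (intro sum.cong refl) (simp only: mult.left_commute)
qed

section \<open>A polynomial over an infinite field is determined by its values\<close>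

text \<open>
  Kronecker's trick: taking the weights from the powers of \<open>B\<close>, the weighted sum of digits below \<open>B\<close>
  is a number whose expansion in base \<open>B\<close> gives the digits back.
\<close>

lemma exists_separating_weight:
  fixes B :: nat
  assumes "finite A" "B > 0"
  shows "\<exists>w :: 'v \<Rightarrow> nat. \<forall>m m'. (\<forall>v\<in>A. m v < B \<and> m' v < B) \<longrightarrow>
      (\<Sum>v\<in>A. w v * m v) = (\<Sum>v\<in>A. w v * m' v) \<longrightarrow> (\<forall>v\<in>A. m v = m' v)"
  using assms(1)
proof induction
  case (insert a A)
  from insert.IH obtain w :: "'v \<Rightarrow> nat" where w: "\<forall>m m'. (\<forall>v\<in>A. m v < B \<and> m' v < B) \<longrightarrow>
      (\<Sum>v\<in>A. w v * m v) = (\<Sum>v\<in>A. w v * m' v) \<longrightarrow> (\<forall>v\<in>A. m v = m' v)"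
    by (rule exE)
  define w' where "w' v = (if v = a then 1 else B * w v)" for v
  have split: "(\<Sum>v\<in>insert a A. w' v * m v) = m a + B * (\<Sum>v\<in>A. w v * m v)" for m
  proof -
    have "(\<Sum>v\<in>A. w' v * m v) = (\<Sum>v\<in>A. B * (w v * m v))"
      using insert.hyps by (intro sum.cong) (auto simp: w'_def)
    then show ?thesis using insert.hyps by (simp add: w'_def sum_distrib_left)
  qed
  have "\<forall>v\<in>insert a A. m v = m' v"
    if bound: "\<forall>v\<in>insert a A. m v < B \<and> m' v < B"
      and eq: "(\<Sum>v\<in>insert a A. w' v * m v) = (\<Sum>v\<in>insert a A. w' v * m' v)" for m m'
  proof -
    let ?S = "\<lambda>m. \<Sum>v\<in>A. w v * m v"
    have e: "m a + B * ?S m = m' a + B * ?S m'" using eq by (simp only: split)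
    have a: "m a < B" "m' a < B" and A: "\<forall>v\<in>A. m v < B \<and> m' v < B"
      using bound by blast+
    have "(m a + B * ?S m) mod B = (m' a + B * ?S m') mod B" by (simp only: e)
    then have ma: "m a = m' a" using a by (simp only: mod_mult_self2 mod_less)
    then have "?S m = ?S m'" using e \<open>B > 0\<close> by (simp only: add_left_cancel mult_cancel1) simp
    then have "\<forall>v\<in>A. m v = m' v" using w A by blast
    with ma show ?thesis by blast
  qed
  then show ?case by (intro exI[of _ w'] allI impI)
qed simp

text \<open>
  Substituting powers \<open>s ^ w v\<close> with separating weights \<open>w\<close> turns distinct monomials of \<open>p\<close> into
  distinct powers of \<open>s\<close>, so no two terms merge, and a polynomial in one variable with infinitely many
  zeros is zero.
\<close>

lemma eq_0_if_eval_eq_0: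
  fixes p :: "('v::finite, 'k::field_char_0) mpoly"
  assumes "\<And>z. eval p z = 0"
  shows "p = 0"
proof (rule poly_mapping_eqI)
  fix m0
  define B where "B = Suc (\<Sum>m\<in>Poly_Mapping.keys p. \<Sum>v\<in>UNIV. Poly_Mapping.lookup m v)"
  have bound: "Poly_Mapping.lookup m v < B" if "m \<in> Poly_Mapping.keys p" for m v
  proof -
    have "Poly_Mapping.lookup m v \<le> (\<Sum>v\<in>UNIV. Poly_Mapping.lookup m v)"
      by (rule member_le_sum) auto
    also have "\<dots> < B"
      unfolding B_def less_Suc_eq_le
      by (rule member_le_sum[of m _ "\<lambda>m. \<Sum>v\<in>UNIV. Poly_Mapping.lookup m v"]) (use that in auto)
    finally show ?thesis .
  qed
  obtain w :: "'v \<Rightarrow> nat" where w: "\<And>m m'. \<forall>v. m v < B \<and> m' v < B \<Longrightarrow>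
      (\<Sum>v\<in>UNIV. w v * m v) = (\<Sum>v\<in>UNIV. w v * m' v) \<Longrightarrow> \<forall>v. m v = m' v"
    using exists_separating_weight[of "UNIV :: 'v set" B] unfolding B_def by auto
  define e where "e m = (\<Sum>v\<in>UNIV. w v * Poly_Mapping.lookup m v)" for m
  have inj: "m = m'" if "m \<in> Poly_Mapping.keys p" "m' \<in> Poly_Mapping.keys p" "e m = e m'" for m m'
    using w[of "Poly_Mapping.lookup m" "Poly_Mapping.lookup m'"] bound that
    by (auto simp: e_def intro: poly_mapping_eqI)
  define f where "f = (\<Sum>m\<in>Poly_Mapping.keys p. monom (Poly_Mapping.lookup p m) (e m))"
  have "poly f s = eval p (\<chi> v. s ^ w v)" for s
    by (simp add: f_def poly_sum poly_monom eval_def subst_def e_def power_sum power_mult)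
  then have "f = 0" using assms by (simp flip: poly_all_0_iff_0)
  show "Poly_Mapping.lookup p m0 = Poly_Mapping.lookup 0 m0"
  proof (cases "m0 \<in> Poly_Mapping.keys p")
    case True
    have "coeff f (e m0) = (\<Sum>m\<in>Poly_Mapping.keys p. if m = m0 then Poly_Mapping.lookup p m else 0)"
      unfolding f_def coeff_sum coeff_monom using inj True by (intro sum.cong) auto
    also have "\<dots> = Poly_Mapping.lookup p m0" using True by simp
    finally show ?thesis using \<open>f = 0\<close> by simp
  qed (simp add: in_keys_iff)
qed

lemma eval_ext:
  fixes p q :: "('v::finite, 'k::field_char_0) mpoly"
  assumes "\<And>z. eval p z = eval q z"
  shows "p = q"
  using eq_0_if_eval_eq_0[of "p - q"] assms by simp

section \<open>Homogeneous components\<close>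

definition component :: "nat \<Rightarrow> ('v::finite, 'k::comm_ring_1) mpoly \<Rightarrow> ('v, 'k) mpoly" where
  "component d p = (\<Sum>m | m \<in> Poly_Mapping.keys p \<and> (\<Sum>v\<in>UNIV. Poly_Mapping.lookup m v) = d.
     Poly_Mapping.single m (Poly_Mapping.lookup p m))"

lemma homogeneous_component: "homogeneous d (component d p)"
proof -
  have "Poly_Mapping.keys (component d p) \<subseteq>
      (\<Union>m\<in>{m \<in> Poly_Mapping.keys p. (\<Sum>v\<in>UNIV. Poly_Mapping.lookup m v) = d}.
        Poly_Mapping.keys (Poly_Mapping.single m (Poly_Mapping.lookup p m)))"
    unfolding component_def by (rule keys_sum)
  then show ?thesis by (auto simp: homogeneous_def split: if_splits)
qed

lemma sum_components:
  "p = (\<Sum>d\<in>(\<lambda>m. \<Sum>v\<in>UNIV. Poly_Mapping.lookup m v) ` Poly_Mapping.keys p. component d p)"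
  using sum.image_gen[OF finite_keys, of "\<lambda>m. Poly_Mapping.single m (Poly_Mapping.lookup p m)" p
      "\<lambda>m. \<Sum>v\<in>UNIV. Poly_Mapping.lookup m v"]
  unfolding component_def sum_monomials .

text \<open>
  On the ray through \<open>z\<close> a polynomial becomes a polynomial in the parameter, and its coefficients are the
  values at \<open>z\<close> of the homogeneous components. So statements about components reduce to comparing
  coefficients.
\<close>

lemma eval_on_ray:
  fixes p :: "('v::finite, 'k::comm_ring_1) mpoly"
  shows "\<exists>f. (\<forall>s. poly f s = eval p (s *s z)) \<and> (\<forall>d. coeff f d = eval (component d p) z)"
proof -
  let ?D = "(\<lambda>m. \<Sum>v\<in>UNIV. Poly_Mapping.lookup m v) ` Poly_Mapping.keys p"
  let ?f = "\<Sum>d\<in>?D. monom (eval (component d p) z) d"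
  have "poly ?f s = eval p (s *s z)" for s
  proof -
    have "eval p (s *s z) = (\<Sum>d\<in>?D. eval (component d p) (s *s z))"
      by (subst (1) sum_components) (simp only: eval_simps)
    then show ?thesis
      by (simp add: poly_sum poly_monom eval_homogeneous[OF homogeneous_component] mult.commute)
  qed
  moreover have "coeff ?f d = eval (component d p) z" for d
  proof (cases "d \<in> ?D")
    case False
    then have "{m \<in> Poly_Mapping.keys p. (\<Sum>v\<in>UNIV. Poly_Mapping.lookup m v) = d} = {}"
      by blast
    then have "component d p = 0" unfolding component_def by (simp only: sum.empty)
    moreover have "coeff ?f d = 0"
      unfolding coeff_sum coeff_monom using False by (intro sum.neutral) auto
    ultimately show ?thesis by (simp only: eval_simps)
  next
    case True
    then show ?thesis by (simp add: coeff_sum coeff_monom)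
  qed
  ultimately show ?thesis by blast
qed

section \<open>The ideal of a linear subspace\<close>

definition vanishing_ideal :: "('k^'v) set \<Rightarrow> ('v::finite, 'k::field_char_0) mpoly set" where
  "vanishing_ideal W = {p. \<forall>z\<in>W. eval p z = 0}"

text \<open>
  The vectors in \<open>V\<close> are read as coefficient vectors of linear forms. The projectivization of
  \<open>annihilator V\<close> is the plane that these forms cut out.
\<close>

definition annihilator :: "('k::field^'v::finite) set \<Rightarrow> ('k^'v) set" where
  "annihilator V = {z. \<forall>c\<in>V. dot c z = 0}"

lemma in_vanishing_ideal [simp]: "p \<in> vanishing_ideal W \<longleftrightarrow> (\<forall>z\<in>W. eval p z = 0)"
  by (simp add: vanishing_ideal_def)

lemma ideal_vanishing_ideal: "ideal.subspace (vanishing_ideal W)"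
  by (simp add: ideal.subspace_def)

text \<open>
  If a form \<open>f\<close> is divisible by a form \<open>l\<close> modulo the ideal of a linear subspace, then the quotient can
  be replaced by its component of the right degree: on every ray in \<open>W\<close> both sides are polynomials in the
  parameter and \<open>f\<close> contributes to one degree only. In particular \<open>f\<close> vanishes on \<open>W\<close> if its degree
  is less than that of \<open>l\<close>.
\<close>

lemma factor_homogeneous:
  fixes f l H :: "('v::finite, 'k::field_char_0) mpoly"
  assumes W: "vec.subspace W" and f: "homogeneous e f" and l: "homogeneous t l"
    and fH: "f - l * H \<in> vanishing_ideal W"
  shows "if e < t then f \<in> vanishing_ideal W
    else f - l * component (e - t) H \<in> vanishing_ideal W"
proof -
  have "eval f z = (if e < t then 0 else eval l z * eval (component (e - t) H) z)" if "z \<in> W" for z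
  proof -
    obtain h where h: "\<And>s. poly h s = eval H (s *s z)"
      and coeff_h: "\<And>d. coeff h d = eval (component d H) z"
      using eval_on_ray[of H z] by blast
    have "poly (monom (eval f z) e - monom (eval l z) t * h) s = 0" for s
    proof -
      have "s *s z \<in> W" using W that by (rule vec.subspace_scale)
      with fH have "eval f (s *s z) = eval l (s *s z) * eval H (s *s z)" by simp
      then show ?thesis
        by (simp add: poly_monom h eval_homogeneous[OF f] eval_homogeneous[OF l] algebra_simps)
    qed
    then have "monom (eval f z) e = monom (eval l z) t * h"
      using poly_all_0_iff_0[of "monom (eval f z) e - monom (eval l z) t * h"] by simp
    from arg_cong[OF this, of "\<lambda>q. coeff q e"] show ?thesis
      by (auto simp: coeff_monom_mult coeff_h)
  qed
  then show ?thesis by simp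
qed

text \<open>
  The ideal is homogeneous because \<open>W\<close> is a union of rays, and prime because \<open>W\<close> contains the line
  joining any two of its points: if \<open>p\<close> is not zero at \<open>a\<close> and \<open>q\<close> is not zero at \<open>b\<close>, then
  neither is zero on the line through \<open>a\<close> and \<open>b\<close>, and so \<open>p * q\<close> is not zero there, because polynomials
  in one variable form a domain.
\<close>

lemma homogeneous_prime_vanishing_ideal:
  fixes W :: "('k::field_char_0^'v::finite) set"
  assumes W: "vec.subspace W"
  shows "homogeneous_prime (vanishing_ideal W)"
proof -
  let ?I = "vanishing_ideal W"
  have component: "component d p \<in> ?I" if "p \<in> ?I" for d p
  proof -
    have "eval (component d p) z = 0" if "z \<in> W" for z
    proof -
      obtain h where h: "\<And>s. poly h s = eval p (s *s z)"
        and coeff_h: "\<And>d. coeff h d = eval (component d p) z"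
        using eval_on_ray[of p z] by blast
      have "poly h s = 0" for s
        unfolding h using vec.subspace_scale[OF W \<open>z \<in> W\<close>] \<open>p \<in> ?I\<close> by simp
      then have "h = 0" by (simp flip: poly_all_0_iff_0)
      then show ?thesis using coeff_h[of d] by simp
    qed
    then show ?thesis by simp
  qed
  have "?I \<subseteq> ideal.span {p \<in> ?I. \<exists>d. homogeneous d p}"
  proof
    fix p assume "p \<in> ?I"
    then have "component d p \<in> ideal.span {p \<in> ?I. \<exists>d. homogeneous d p}" for d
      using component homogeneous_component by (intro ideal.span_base) blast
    then show "p \<in> ideal.span {p \<in> ?I. \<exists>d. homogeneous d p}"
      by (subst sum_components) (rule ideal.span_sum)
  qed
  moreover have "ideal.span {p \<in> ?I. \<exists>d. homogeneous d p} \<subseteq> ?I"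
    by (rule ideal.span_minimal) (auto simp: ideal_vanishing_ideal simp del: in_vanishing_ideal)
  ultimately have "homogeneous_ideal ?I"
    unfolding homogeneous_ideal_def using ideal_vanishing_ideal by blast
  moreover have "1 \<notin> ?I"
    using vec.subspace_0[OF W] by auto
  moreover have "p \<in> ?I \<or> q \<in> ?I" if "p * q \<in> ?I" for p q
  proof (rule ccontr)
    assume "\<not> (p \<in> ?I \<or> q \<in> ?I)"
    then obtain a b where a: "a \<in> W" "eval p a \<noteq> 0" and b: "b \<in> W" "eval q b \<noteq> 0" by auto
    obtain f where f: "\<And>s. poly f s = eval p (a + s *s (b - a))"
      using eval_on_line[of p a "b - a"] by blast
    obtain g where g: "\<And>s. poly g s = eval q (a + s *s (b - a))"
      using eval_on_line[of q a "b - a"] by blast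
    have "poly (f * g) s = 0" for s
    proof -
      have "a + s *s (b - a) \<in> W"
        using a b W by (simp add: vec.subspace_add vec.subspace_diff vec.subspace_scale)
      with that show ?thesis by (simp add: f g)
    qed
    then have "f * g = 0" using poly_all_0_iff_0 by blast
    then have "f = 0 \<or> g = 0" by simp
    then show False using f[of 0] g[of 1] a b by auto
  qed
  ultimately show ?thesis unfolding homogeneous_prime_def by blast
qed

lemma dot_simps:
  "dot (c + d) z = dot c z + dot d z" "dot (c - d) z = dot c z - dot d z"
  "dot (k *s c) z = k * dot c z" "dot c (z + w) = dot c z + dot c w" "dot c (k *s z) = k * dot c z"
  "dot 0 z = 0" "dot c 0 = 0"
  by (simp_all add: dot_def sum.distrib sum_subtractf sum_distrib_left algebra_simps)

lemma dot_axis [simp]: "dot (axis v 1) z = z $ v"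
proof -
  have "axis v 1 $ u * z $ u = (if u = v then z $ u else 0)" for u
    by (simp add: axis_def)
  then show ?thesis by (simp add: dot_def)
qed

lemma X_eq_linear_form:
  fixes v :: "'v::finite"
  shows "(X v :: ('v, 'k::field_char_0) mpoly) = linear_form (axis v 1)"
  by (rule eval_ext) simp

lemma subspace_annihilator: "vec.subspace (annihilator V)"
  by (simp add: vec.subspace_def annihilator_def dot_simps)

text \<open>
  Extending a basis of \<open>V\<close> by \<open>c\<close> gives a linear functional that is zero on \<open>V\<close> but not at \<open>c\<close>. It is
  obtained as a row of the matrix of a linear map.
\<close>

lemma exists_annihilator_not_orthogonal:
  fixes V :: "('k::field^'v::finite) set"
  assumes V: "vec.subspace V" and c: "c \<notin> V"
  shows "\<exists>z\<in>annihilator V. dot c z \<noteq> 0"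
proof -
  obtain B where B: "B \<subseteq> V" "vec.independent B" "V \<subseteq> vec.span B"
    by (rule vec.maximal_independent_subset)
  have "vec.span B \<subseteq> V" using B V by (intro vec.span_minimal)
  with c B have "vec.independent (insert c B)" by (subst vec.independent_insert) auto
  then obtain g :: "'k^'v \<Rightarrow> 'k^'v" where g: "Vector_Spaces.linear (*s) (*s) g"
    and g_basis: "\<forall>x\<in>insert c B. g x = (if x = c then 1 else 0)"
    using vec.linear_independent_extend[of "insert c B" "\<lambda>x. if x = c then 1 else 0"] by blast
  \<comment> \<open>The value \<open>g c\<close> is the vector with all entries one, so any row of the matrix serves.\<close>
  fix i :: 'v
  define z where "z = matrix g $ i"
  have dot_z: "dot x z = g x $ i" for x
    using matrix_works[OF g, of x]
    by (auto simp: z_def dot_def matrix_vector_mult_def vec_eq_iff mult.commute)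
  have "g x = 0" if "x \<in> V" for x
  proof (rule vec.linear_eq_0_on_span[OF g])
    show "x \<in> vec.span B" using that B by blast
    show "g y = 0" if "y \<in> B" for y using that g_basis B c by auto
  qed
  then have "z \<in> annihilator V" by (simp add: annihilator_def dot_z)
  moreover have "dot c z \<noteq> 0" using g_basis by (simp add: dot_z)
  ultimately show ?thesis by blast
qed

lemma exists_projection_matrix:
  fixes W :: "('k::field^'v::finite) set"
  assumes W: "vec.subspace W"
  shows "\<exists>A :: 'k^'v^'v. (\<forall>z. A *v z \<in> W) \<and> (\<forall>z\<in>W. A *v z = z)"
proof -
  obtain B where B: "B \<subseteq> W" "vec.independent B" "W \<subseteq> vec.span B"
    by (rule vec.maximal_independent_subset)
  have span: "vec.span B = W" using B W by (intro equalityI vec.span_minimal)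
  obtain g where g: "Vector_Spaces.linear (*s) (*s) g" "\<forall>x\<in>B. g x = x" "range g = vec.span B"
    using vec.linear_independent_extend_subspace[OF B(2), of "\<lambda>x. x"] by auto
  have "g z = z" if "z \<in> W" for z
    using vec.linear_eq_on_span[OF g(1) vec.linear_id, of B z] g(2) that span by auto
  moreover have "g z \<in> W" for z using g(3) span by auto
  ultimately show ?thesis
    using matrix_works[OF g(1)] by metis
qed

lemma prod_cong_ideal:
  assumes I: "ideal.subspace I" and "\<And>v. v \<in> A \<Longrightarrow> a v - b v \<in> I"
  shows "prod a A - prod b A \<in> I"
  using assms(2)
proof (induction A rule: infinite_finite_induct)
  case (insert v A)
  have "a v * prod a A - b v * prod b A = prod a A * (a v - b v) + b v * (prod a A - prod b A)"
    by (simp add: algebra_simps)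
  then show ?case
    using insert by (simp add: ideal.subspace_add[OF I] ideal.subspace_scale[OF I])
qed (simp_all add: ideal.subspace_0[OF I])

lemma power_cong_ideal:
  assumes "ideal.subspace I" "a - b \<in> I"
  shows "a ^ n - b ^ n \<in> I"
  using prod_cong_ideal[OF assms(1), of "{..<n}" "\<lambda>_. a" "\<lambda>_. b"] assms(2) by simp

text \<open>
  A polynomial does not change modulo an ideal when every variable is replaced by something congruent.
\<close>

lemma subst_cong_ideal:
  fixes p :: "('v::finite, 'k::comm_ring_1) mpoly"
  assumes I: "ideal.subspace I" and f: "\<And>v. X v - f v \<in> I"
  shows "p - subst (Poly_Mapping.single 0) f p \<in> I"
proof -
  have "h * (\<Prod>v\<in>UNIV. X v ^ m v) - h * (\<Prod>v\<in>UNIV. f v ^ m v) \<in> I" for h and m :: "'v \<Rightarrow> nat"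
    unfolding right_diff_distrib[symmetric]
    by (intro ideal.subspace_scale I prod_cong_ideal power_cong_ideal f)
  then have "subst (Poly_Mapping.single 0) X p - subst (Poly_Mapping.single 0) f p \<in> I"
    unfolding subst_def sum_subtractf[symmetric] by (intro ideal.subspace_sum I)
  then show ?thesis by (simp only: subst_X_self)
qed

text \<open>
  Nullstellensatz for linear subspaces. Let \<open>A\<close> be a projection onto \<open>W = annihilator V\<close>. The
  substitution of \<open>A X\<close> for \<open>X\<close> does not change \<open>p\<close> modulo the linear forms in \<open>V\<close>, and it turns a
  polynomial that vanishes on \<open>W\<close> into one that vanishes everywhere. Through this lemma, congruences
  modulo the ideal of a plane can be checked pointwise.
\<close>

lemma span_linear_forms:
  fixes V :: "('k::field_char_0^'v::finite) set"
  assumes V: "vec.subspace V"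
  shows "ideal.span (linear_form ` V) = vanishing_ideal (annihilator V)"
proof
  show "ideal.span (linear_form ` V) \<subseteq> vanishing_ideal (annihilator V)"
    by (rule ideal.span_minimal) (auto simp: ideal_vanishing_ideal annihilator_def)
  let ?W = "annihilator V"
  obtain A :: "'k^'v^'v" where A: "\<And>z. A *v z \<in> ?W" "\<And>z. z \<in> ?W \<Longrightarrow> A *v z = z"
    using exists_projection_matrix[OF subspace_annihilator, of V] by blast
  have dot_A: "dot (A $ v) z = (A *v z) $ v" for v z
    by (simp add: dot_def matrix_vector_mult_def)
  have "X v - linear_form (A $ v) \<in> ideal.span (linear_form ` V)" for v
  proof -
    have "axis v 1 - A $ v \<in> V"
    proof (rule ccontr)
      assume "axis v 1 - A $ v \<notin> V"
      then obtain z where z: "z \<in> ?W" "dot (axis v 1 - A $ v) z \<noteq> 0"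
        using exists_annihilator_not_orthogonal[OF V] by blast
      then show False using A(2)[of z] by (simp add: dot_simps dot_A)
    qed
    then have "linear_form (axis v 1 - A $ v) \<in> ideal.span (linear_form ` V)"
      by (intro ideal.span_base imageI)
    also have "linear_form (axis v 1 - A $ v) = X v - linear_form (A $ v)"
      by (rule eval_ext) (simp add: dot_simps)
    finally show ?thesis .
  qed
  note congr = subst_cong_ideal[OF ideal.subspace_span this]
  show "vanishing_ideal ?W \<subseteq> ideal.span (linear_form ` V)"
  proof
    fix p assume p: "p \<in> vanishing_ideal ?W"
    have "(\<chi> v. (A *v z) $ v) = A *v z" for z by (simp add: vec_eq_iff)
    with p A(1) have "subst (Poly_Mapping.single 0) (\<lambda>v. linear_form (A $ v)) p = 0"
      by (intro eq_0_if_eval_eq_0) (simp add: eval_subst dot_A)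
    with congr[of p] show "p \<in> ideal.span (linear_form ` V)" by simp
  qed
qed

lemma linear_form_in_span_iff:
  fixes V :: "('k::field_char_0^'v::finite) set"
  assumes V: "vec.subspace V"
  shows "linear_form c \<in> ideal.span (linear_form ` V) \<longleftrightarrow> c \<in> V"
  using exists_annihilator_not_orthogonal[OF V, of c]
  by (auto simp: span_linear_forms[OF V]) (auto simp: annihilator_def)

lemma linear_form_simps:
  fixes c d :: "'k::field_char_0^'v::finite"
  shows "linear_form (c + d) = linear_form c + linear_form d"
    and "linear_form (k *s c) = Poly_Mapping.single 0 k * linear_form c"
  by (rule eval_ext; simp add: dot_simps)+

lemma homogeneous_linear_form: "homogeneous 1 (linear_form c)"
proof -
  have "Poly_Mapping.keys (linear_form c) \<subseteq>
      (\<Union>v. Poly_Mapping.keys (Poly_Mapping.single (Poly_Mapping.single v 1) (c $ v)))"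
    unfolding linear_form_def by (rule keys_sum)
  then have "\<exists>v. m = Poly_Mapping.single v 1" if "m \<in> Poly_Mapping.keys (linear_form c)" for m
    using that by (fastforce split: if_splits)
  then show ?thesis
    by (fastforce simp: homogeneous_def lookup_single when_def)
qed

lemma homogeneous_mult:
  assumes "homogeneous d p" "homogeneous e q"
  shows "homogeneous (d + e) (p * q)"
  using assms keys_mult[of p q] by (fastforce simp: homogeneous_def lookup_add sum.distrib)

lemma homogeneous_power_linear_form: "homogeneous n (linear_form c ^ n)"
proof (induction n)
  case (Suc n)
  then show ?case using homogeneous_mult[OF homogeneous_linear_form[of c]] by fastforce
qed (simp add: homogeneous_def)

section \<open>Prime ideals and cancellation\<close>

lemma homogeneous_primeD:
  assumes "homogeneous_prime P"
  shows homogeneous_prime_ideal: "ideal.subspace P"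
    and homogeneous_prime_one: "1 \<notin> P"
    and homogeneous_prime_mult: "p * q \<in> P \<Longrightarrow> p \<in> P \<or> q \<in> P"
  using assms by (auto simp: homogeneous_prime_def homogeneous_ideal_def)

lemma homogeneous_prime_power:
  assumes "homogeneous_prime P" "p ^ n \<in> P"
  shows "p \<in> P"
  using assms(2)
  by (induction n) (auto dest: homogeneous_prime_mult[OF assms(1)]
      simp: homogeneous_prime_one[OF assms(1)])

lemma in_span_insert_iff:
  assumes "ideal.subspace P"
  shows "x \<in> ideal.span (insert a P) \<longleftrightarrow> (\<exists>k. x - k * a \<in> P)"
  using assms by (simp add: ideal.span_breakdown_eq ideal.span_eq_iff[THEN iffD2])

lemma ideal_congD:
  assumes "ideal.subspace P" "a - b \<in> P"
  shows "a \<in> P \<longleftrightarrow> b \<in> P"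
  using ideal.subspace_add[OF assms(1), of "a - b" b] ideal.subspace_diff[OF assms(1), of a "a - b"]
    assms(2) by auto

text \<open>
  Modulo the prime \<open>P\<close> the element \<open>m\<close> is again prime and does not divide \<open>w\<close>, so the power \<open>m ^ N\<close>, which
  divides \<open>w * b\<close>, must divide \<open>b\<close>: one factor \<open>m\<close> is removed at a time. This replaces unique
  factorization in the coordinate ring of a plane.
\<close>

lemma cancel_modulo_prime:
  assumes P: "ideal.subspace P" and prime: "\<And>x y. x * y \<in> P \<Longrightarrow> x \<in> P \<or> y \<in> P"
    and m: "m \<notin> P"
    and primeQ: "\<And>x y. x * y \<in> ideal.span (insert m P) \<Longrightarrow>
      x \<in> ideal.span (insert m P) \<or> y \<in> ideal.span (insert m P)"
    and w: "w \<notin> ideal.span (insert m P)"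
    and eq: "m ^ N * a - w * b \<in> P"
  shows "b \<in> ideal.span (insert (m ^ N) P)"
  using eq
proof (induction N arbitrary: b)
  case 0
  then show ?case by (auto simp: in_span_insert_iff[OF P] ideal.subspace_0[OF P] intro: exI[of _ b])
next
  case (Suc N)
  have "w * b - (m ^ N * a) * m \<in> P"
    using ideal.subspace_neg[OF P Suc.prems] by (simp add: algebra_simps)
  then have "w * b \<in> ideal.span (insert m P)"
    unfolding in_span_insert_iff[OF P] by blast
  with primeQ w obtain k where k: "b - k * m \<in> P"
    unfolding in_span_insert_iff[OF P] by blast
  have "m * (m ^ N * a - w * k) = (m ^ Suc N * a - w * b) + w * (b - k * m)"
    by (simp add: algebra_simps)
  also have "\<dots> \<in> P"
    by (intro ideal.subspace_add ideal.subspace_scale P Suc.prems k)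
  finally have "m ^ N * a - w * k \<in> P" using prime m by blast
  from Suc.IH[OF this] obtain j where j: "k - j * m ^ N \<in> P"
    unfolding in_span_insert_iff[OF P] by blast
  have "b - j * m ^ Suc N = (b - k * m) + m * (k - j * m ^ N)"
    by (simp add: algebra_simps)
  also have "\<dots> \<in> P"
    by (intro ideal.subspace_add ideal.subspace_scale P j k)
  finally show ?case unfolding in_span_insert_iff[OF P] by blast
qed

section \<open>Ideals of planes\<close>

lemma homogeneous_prime_span_linear_forms:
  fixes V :: "('k::field_char_0^'v::finite) set"
  assumes "vec.subspace V"
  shows "homogeneous_prime (ideal.span (linear_form ` V))"
  unfolding span_linear_forms[OF assms]
  by (rule homogeneous_prime_vanishing_ideal[OF subspace_annihilator])

lemma span_insert_linear_form:
  fixes V :: "('k::field_char_0^'v::finite) set"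
  assumes V: "vec.subspace V"
  shows "ideal.span (insert (linear_form c) (ideal.span (linear_form ` V))) =
    ideal.span (linear_form ` vec.span (insert c V))" (is "?L = ?R")
proof
  show "?L \<subseteq> ?R"
  proof (rule ideal.span_minimal)
    have "linear_form c \<in> ?R"
      by (intro ideal.span_base imageI vec.span_base) simp
    moreover have "ideal.span (linear_form ` V) \<subseteq> ?R"
      by (intro ideal.span_mono image_mono) (auto intro: vec.span_base)
    ultimately show "insert (linear_form c) (ideal.span (linear_form ` V)) \<subseteq> ?R" by blast
  qed simp
  show "?R \<subseteq> ?L"
  proof (rule ideal.span_minimal)
    show "linear_form ` vec.span (insert c V) \<subseteq> ?L"
    proof
      fix x assume "x \<in> linear_form ` vec.span (insert c V)"
      then obtain d k where x: "x = linear_form d" and d: "d - k *s c \<in> V"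
        using V by (auto simp: vec.span_breakdown_eq vec.span_eq_iff[THEN iffD2])
      have "x = linear_form ((d - k *s c) + k *s c)" by (simp add: x)
      also have "\<dots> = linear_form (d - k *s c) + Poly_Mapping.single 0 k * linear_form c"
        by (simp only: linear_form_simps)
      also have "\<dots> \<in> ?L"
        using d by (intro ideal.span_add ideal.span_scale) (auto intro: ideal.span_base)
      finally show "x \<in> ?L" .
    qed
  qed simp
qed

lemma homogeneous_prime_insert_linear_form:
  fixes V :: "('k::field_char_0^'v::finite) set"
  assumes "vec.subspace V"
  shows "homogeneous_prime (ideal.span (insert (linear_form c) (ideal.span (linear_form ` V))))"
  unfolding span_insert_linear_form[OF assms]
  by (rule homogeneous_prime_span_linear_forms) simp

lemma cancel_modulo_plane:
  fixes V :: "('k::field_char_0^'v::finite) set"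
  assumes V: "vec.subspace V" and c: "c \<notin> V"
    and "w \<notin> ideal.span (insert (linear_form c) (ideal.span (linear_form ` V)))"
    and "linear_form c ^ N * a - w * b \<in> ideal.span (linear_form ` V)"
  shows "b \<in> ideal.span (insert (linear_form c ^ N) (ideal.span (linear_form ` V)))"
proof (rule cancel_modulo_prime[OF _ _ _ _ assms(3,4)])
  show "linear_form c \<notin> ideal.span (linear_form ` V)"
    using c by (simp add: linear_form_in_span_iff[OF V])
qed (use homogeneous_primeD[OF homogeneous_prime_span_linear_forms[OF V]]
      homogeneous_primeD[OF homogeneous_prime_insert_linear_form[OF V]] in auto)

text \<open>
  The projective space of a nonzero vector space is not empty: some coordinate does not vanish on it.
\<close>

lemma exists_X_notin_span_linear_forms:
  fixes V :: "('k::field_char_0^'v::finite) set"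
  assumes V: "vec.subspace V" and dim: "vec.dim V < CARD('v)"
  shows "\<exists>v. X v \<notin> ideal.span (linear_form ` V)"
proof (rule ccontr)
  assume "\<not> ?thesis"
  then have "axis v 1 \<in> V" for v
    by (simp add: X_eq_linear_form linear_form_in_span_iff[OF V])
  then have "(\<Sum>v\<in>UNIV. c $ v *s axis v 1) \<in> V" for c :: "'k^'v"
    by (intro vec.subspace_sum vec.subspace_scale V)
  then have "V = UNIV" by (auto simp: basis_expansion)
  then have "vec.dim V = CARD('v)" by (simp only: vec_dim_card)
  with dim show False by simp
qed

section \<open>Sections restricted to a plane\<close>

text \<open>
  On a projective space of dimension at least one, every global section of \<open>\<O>(t)\<close> is a form of degree
  \<open>t\<close>. Because of the dimension there are a coordinate \<open>X v\<close> that is not zero on the plane and a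
  coordinate \<open>X u\<close> that is not divisible by \<open>X v\<close> there. As the section agrees on the two charts,
  \<open>X v ^ N\<close> divides \<open>X u ^ N * g v\<close>, hence divides \<open>g v\<close>. The quotient describes the section on all
  charts.
\<close>

lemma section_on_plane_is_form:
  fixes V :: "('k::field_char_0^'v::finite) set"
  assumes V: "vec.subspace V" and dim: "vec.dim V + 2 \<le> CARD('v)"
    and Y': "Y' \<subseteq> ideal.span (linear_form ` V)"
    and sect: "is_section Y' t N g"
  shows "\<exists>G. homogeneous t G \<and> (\<forall>w. X w \<notin> ideal.span (linear_form ` V) \<longrightarrow>
    g w - X w ^ N * G \<in> ideal.span (linear_form ` V))"
proof -
  let ?P = "ideal.span (linear_form ` V)"
  note prime = homogeneous_prime_span_linear_forms[OF V]
  note P = homogeneous_prime_ideal[OF prime]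
  obtain v where v: "X v \<notin> ?P"
    using exists_X_notin_span_linear_forms[OF V] dim by auto
  let ?V' = "vec.span (insert (axis v 1) V)"
  have "vec.dim ?V' < CARD('v)"
    unfolding vec.dim_span using dim by (simp add: vec.dim_insert)
  then obtain u where "X u \<notin> ideal.span (linear_form ` ?V')"
    using exists_X_notin_span_linear_forms[of ?V'] by auto
  then have u: "X u \<notin> ideal.span (insert (X v) ?P)"
    unfolding X_eq_linear_form span_insert_linear_form[OF V] .
  \<comment> \<open>The plane is integral, so the denominators hidden in the definition of a section can be cancelled.\<close>
  have agree: "X w ^ N * g u - X u ^ N * g w \<in> ?P" if "X w \<notin> ?P" "X u \<notin> ?P" for u w
  proof -
    obtain M where "(X u * X w) ^ M * (X w ^ N * g u - X u ^ N * g w) \<in> ?P"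
      using sect Y' unfolding is_section_def on_chart_def by blast
    then show ?thesis
      using that homogeneous_prime_mult[OF prime] homogeneous_prime_power[OF prime] by blast
  qed
  have "X u \<notin> ?P" using u ideal.span_base by blast
  have "X u ^ N \<notin> ideal.span (insert (X v) ?P)"
    using u homogeneous_prime_power[OF homogeneous_prime_insert_linear_form[OF V]]
    unfolding X_eq_linear_form by blast
  moreover have "axis v 1 \<notin> V" using v by (simp add: X_eq_linear_form linear_form_in_span_iff[OF V])
  ultimately have "g v \<in> ideal.span (insert (X v ^ N) ?P)"
    using agree[OF v \<open>X u \<notin> ?P\<close>] cancel_modulo_plane[OF V, of "axis v 1"]
    unfolding X_eq_linear_form by blast
  then obtain H where H: "g v - X v ^ N * H \<in> ?P"
    unfolding in_span_insert_iff[OF P] by (auto simp: mult.commute)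
  define G where "G = component t H"
  have Gv: "g v - X v ^ N * G \<in> ?P"
  proof -
    have "homogeneous (t + N) (g v)" using sect by (simp add: is_section_def)
    moreover have "homogeneous N (X v ^ N :: ('v, 'k) mpoly)"
      unfolding X_eq_linear_form by (rule homogeneous_power_linear_form)
    ultimately show ?thesis
      using factor_homogeneous[OF subspace_annihilator, of "t + N" "g v" N "X v ^ N" H V] H
      unfolding span_linear_forms[OF V] G_def by (simp del: in_vanishing_ideal)
  qed
  have "g w - X w ^ N * G \<in> ?P" if w: "X w \<notin> ?P" for w
  proof -
    have "X v ^ N * (g w - X w ^ N * G) = (X v ^ N * g w - X w ^ N * g v) + X w ^ N * (g v - X v ^ N * G)"
      by (simp add: algebra_simps)
    also have "\<dots> \<in> ?P"
      by (intro ideal.subspace_add ideal.subspace_scale P agree Gv v w)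
    finally show ?thesis
      using v homogeneous_prime_mult[OF prime] homogeneous_prime_power[OF prime] by blast
  qed
  then show ?thesis using homogeneous_component unfolding G_def by blast
qed

lemma on_chart_self: "p \<in> I \<Longrightarrow> p \<in> on_chart f I"
  unfolding on_chart_def by (auto intro!: exI[of _ "0::nat"])

text \<open>
  At a point of the chart of \<open>X w\<close> the powers of \<open>X w\<close> are units. So the local equation
  decides there whether the point of \<open>Y'\<close> lies on \<open>Y\<close>, and it may be replaced by any \<open>G\<close> that agrees
  with it up to \<open>X w ^ N\<close>.
\<close>

lemma zero_scheme_subset_prime_iff:
  assumes zs: "is_zero_scheme Y' g Y" and P: "homogeneous_prime P" and Y': "Y' \<subseteq> P"
    and w: "X w \<notin> P" and G: "g w - X w ^ N * G \<in> P"
  shows "Y \<subseteq> P \<longleftrightarrow> G \<in> P"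
proof -
  note I = homogeneous_prime_ideal[OF P]
  have cancel: "p \<in> P" if "X w ^ M * p \<in> P" for M p
    using that w homogeneous_prime_mult[OF P] homogeneous_prime_power[OF P] by blast
  have chart: "on_chart (X w) Y = on_chart (X w) (ideal.span (insert (g w) Y'))"
    using zs by (simp add: is_zero_scheme_def)
  have "g w \<in> P \<longleftrightarrow> X w ^ N * G \<in> P" by (rule ideal_congD[OF I G])
  then have gG: "g w \<in> P \<longleftrightarrow> G \<in> P" using cancel ideal.subspace_scale[OF I] by blast
  show ?thesis
  proof
    assume "Y \<subseteq> P"
    have "g w \<in> on_chart (X w) Y"
      unfolding chart by (intro on_chart_self ideal.span_base) simp
    then have "g w \<in> P" using \<open>Y \<subseteq> P\<close> cancel unfolding on_chart_def by blast
    then show "G \<in> P" by (simp add: gG)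
  next
    assume "G \<in> P"
    then have "insert (g w) Y' \<subseteq> P" using gG Y' by blast
    then have span: "ideal.span (insert (g w) Y') \<subseteq> P" by (rule ideal.span_minimal[OF _ I])
    show "Y \<subseteq> P"
    proof
      fix y assume "y \<in> Y"
      then have "y \<in> on_chart (X w) (ideal.span (insert (g w) Y'))"
        unfolding chart[symmetric] by (rule on_chart_self)
      then show "y \<in> P" using span cancel unfolding on_chart_def by blast
    qed
  qed
qed

text \<open>
  Let \<open>G\<close> be a form of degree \<open>t\<close> whose zeros on the plane all lie on the hyperplane \<open>c = 0\<close>. On a line
  contained in the affine space \<open>c = 1\<close> it restricts to a polynomial without roots, which is a constant
  since the field is algebraically closed. So \<open>G\<close> is constant on \<open>c = 1\<close>, and by homogeneity \<open>G\<close> is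
  a multiple of \<open>c ^ t\<close> wherever \<open>c\<close> is not zero. Multiplying the difference by \<open>c\<close> makes it vanish on
  the whole plane, and \<open>c\<close> cancels because the ideal of the plane is prime.
\<close>

lemma form_without_zeros_off_hyperplane:
  fixes V :: "('k::{alg_closed_field, field_char_0}^'v::finite) set"
  assumes V: "vec.subspace V" and c: "c \<notin> V" and G: "homogeneous t G"
    and zeros: "\<And>z. z \<in> annihilator V \<Longrightarrow> eval G z = 0 \<Longrightarrow> dot c z = 0"
  shows "G \<in> ideal.span (insert (linear_form c ^ t) (ideal.span (linear_form ` V)))"
proof -
  let ?W = "annihilator V" and ?P = "ideal.span (linear_form ` V)"
  note prime = homogeneous_prime_span_linear_forms[OF V]
  note W = subspace_annihilator[of V]
  obtain e' where e': "e' \<in> ?W" "dot c e' \<noteq> 0"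
    using exists_annihilator_not_orthogonal[OF V c] by blast
  define e where "e = (1 / dot c e') *s e'"
  have e: "e \<in> ?W" "dot c e = 1"
    using e' by (auto simp: e_def dot_simps vec.subspace_scale[OF W])
  have const: "eval G z = eval G e * dot c z ^ t" if z: "z \<in> ?W" "dot c z \<noteq> 0" for z
  proof -
    define z' where "z' = (1 / dot c z) *s z"
    have z': "z' \<in> ?W" "dot c z' = 1" "z = dot c z *s z'"
      using z by (auto simp: z'_def dot_simps vec.subspace_scale[OF W])
    obtain h where h: "\<And>s. poly h s = eval G (e + s *s (z' - e))"
      using eval_on_line[of G e "z' - e"] by blast
    have "poly h s \<noteq> 0" for s
    proof
      assume "poly h s = 0"
      moreover have "e + s *s (z' - e) \<in> ?W"
        using e z' W by (simp add: vec.subspace_add vec.subspace_diff vec.subspace_scale)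
      ultimately have "dot c (e + s *s (z' - e)) = 0" using zeros by (simp add: h)
      moreover have "dot c (z' - e) = 0"
        using dot_simps(4)[of c "z' - e" e] by (simp add: e z')
      then have "dot c (e + s *s (z' - e)) = 1"
        unfolding dot_simps(4,5) by (simp add: e)
      ultimately show False by simp
    qed
    then have "degree h = 0" using alg_closed_imp_poly_has_root[of h] by blast
    then obtain a where "h = [:a:]" by (rule degree_eq_zeroE)
    then have "eval G e = eval G z'" using h[of 0] h[of 1] by simp
    then show ?thesis
      using eval_homogeneous[OF G, of "dot c z" z'] by (simp flip: z'(3))
  qed
  define D where "D = G - Poly_Mapping.single 0 (eval G e) * linear_form c ^ t"
  have "linear_form c * D \<in> ?P"
    unfolding span_linear_forms[OF V] D_def using const by auto
  moreover have "linear_form c \<notin> ?P" using c by (simp add: linear_form_in_span_iff[OF V])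
  ultimately have "D \<in> ?P" using homogeneous_prime_mult[OF prime] by blast
  then show ?thesis
    unfolding in_span_insert_iff[OF homogeneous_prime_ideal[OF prime]] D_def by blast
qed


section \<open>Strong planes and fat planes\<close>

lemma point_on_zero_scheme_iff_form_vanishes:
  fixes V :: "('k::field_char_0^'v::finite) set"
  assumes zs: "is_zero_scheme Y' g Y" and Y': "Y' \<subseteq> ideal.span (linear_form ` V)"
    and G: "\<forall>w. X w \<notin> ideal.span (linear_form ` V) \<longrightarrow>
      g w - X w ^ N * G \<in> ideal.span (linear_form ` V)"
    and P: "P \<in> points (ideal.span (linear_form ` V))"
  shows "P \<in> points Y \<longleftrightarrow> G \<in> P"
proof -
  obtain w where w: "X w \<notin> P" using P by (auto simp: points_def)
  have VP: "ideal.span (linear_form ` V) \<subseteq> P" using P by (simp add: points_def)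
  have "Y \<subseteq> P \<longleftrightarrow> G \<in> P"
    by (rule zero_scheme_subset_prime_iff[OF zs _ _ w]) (use P Y' VP G w in \<open>auto simp: points_def\<close>)
  then show ?thesis using P by (auto simp: points_def)
qed

lemma plane_in_own_points:
  fixes L :: "('v::finite, 'k::field_char_0) mpoly set"
  assumes "plane r L"
  shows "L \<in> points L"
proof -
  obtain V :: "('k^'v) set" where V: "vec.subspace V" "vec.dim V + (r + 1) = CARD('v)"
    "L = ideal.span (linear_form ` V)"
    using assms by (auto simp: plane_def)
  then show ?thesis
    using exists_X_notin_span_linear_forms[OF V(1)] homogeneous_prime_span_linear_forms[OF V(1)]
    by (simp add: points_def)
qed

text \<open>
  An \<open>r\<close>-plane contained in an \<open>(r + 1)\<close>-plane is a hyperplane in it.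
\<close>

lemma plane_contained_in_plane:
  fixes L L' :: "('v::finite, 'k::field_char_0) mpoly set"
  assumes "plane r L" and V: "vec.subspace V" "vec.dim V + (r + 2) = CARD('v)"
    and L': "L' = ideal.span (linear_form ` V)" "L' \<subseteq> L"
  shows "\<exists>c. c \<notin> V \<and> L = ideal.span (insert (linear_form c) L')"
proof -
  obtain U :: "('k^'v) set" where U: "vec.subspace U" "vec.dim U + (r + 1) = CARD('v)"
    "L = ideal.span (linear_form ` U)"
    using assms(1) by (auto simp: plane_def)
  have "V \<subseteq> U"
    using L' linear_form_in_span_iff[OF V(1)] linear_form_in_span_iff[OF U(1)]
    unfolding U(3) by blast
  moreover have "V \<noteq> U" using V(2) U(2) by auto
  ultimately obtain c where c: "c \<in> U" "c \<notin> V" by blast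
  have span_V: "vec.span V = V" using V(1) by simp
  have "vec.span (insert c V) = U"
  proof (rule vec.subspace_dim_equal)
    show "vec.span (insert c V) \<subseteq> U"
      using c \<open>V \<subseteq> U\<close> by (intro vec.span_minimal U) auto
    show "vec.dim U \<le> vec.dim (vec.span (insert c V))"
      unfolding vec.dim_span using c V U(2) by (simp add: vec.dim_insert span_V)
  qed (simp_all add: U)
  then show ?thesis
    using c unfolding L' span_insert_linear_form[OF V(1)] U(3) by blast
qed

text \<open>
  If \<open>L'\<close> lies in \<open>Y\<close>, every fat plane in \<open>L'\<close> does. Otherwise the form \<open>G\<close> by which the section restricts
  to \<open>L'\<close> vanishes at most on \<open>L\<close>, so that it is a multiple of the \<open>t\<close>-th power of the equation of \<open>L\<close>.
  Then \<open>Y\<close> contains the fat plane on a chart that meets \<open>L\<close>; this is enough, because the fat plane has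
  no component outside the chart.
\<close>

lemma strong_plane_supports_fat_plane:
  fixes Y' Y :: "('v::finite, 'k::{alg_closed_field, field_char_0}) mpoly set"
  assumes sect: "is_section Y' t N g" and zs: "is_zero_scheme Y' g Y"
    and strong: "strong_plane r Y' Y L"
  shows "\<exists>Z. fat_plane_with_support t r Z L \<and> contained_in Z Y"
proof -
  obtain L' where L: "plane r L" and L': "plane (r + 1) L'" and Y': "Y' \<subseteq> L'" and "L' \<subseteq> L"
    and cases: "points L' \<inter> points Y = points L \<or> points L' \<inter> points Y = points L'"
    using strong by (auto simp: strong_plane_def contained_in_def)
  obtain V :: "('k^'v) set" where V: "vec.subspace V" "vec.dim V + (r + 2) = CARD('v)"
    and L'_eq: "L' = ideal.span (linear_form ` V)"
    using L' by (auto simp: plane_def)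
  obtain c where c: "c \<notin> V" and L_eq: "L = ideal.span (insert (linear_form c) L')"
    using plane_contained_in_plane[OF L V L'_eq \<open>L' \<subseteq> L\<close>] by blast
  let ?Z = "ideal.span (insert (linear_form c ^ t) L')"
  have "L' \<subseteq> ?Z" using ideal.span_superset by blast
  have "Y \<subseteq> ?Z"
    using cases
  proof
    assume "points L' \<inter> points Y = points L'"
    then have "Y \<subseteq> L'" using plane_in_own_points[OF L'] by (auto simp: points_def)
    with \<open>L' \<subseteq> ?Z\<close> show ?thesis by blast
  next
    assume eq: "points L' \<inter> points Y = points L"
    obtain G where G: "homogeneous t G"
      and gG: "\<forall>w. X w \<notin> ideal.span (linear_form ` V) \<longrightarrow>
        g w - X w ^ N * G \<in> ideal.span (linear_form ` V)"
      using section_on_plane_is_form[OF V(1) _ _ sect] V(2) Y' unfolding L'_eq by auto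
    have "dot c z = 0" if z: "z \<in> annihilator V" "eval G z = 0" for z
    proof (cases "z = 0")
      case False
      then obtain w where w: "z $ w \<noteq> 0" by (auto simp: vec_eq_iff)
      \<comment> \<open>The ideal of the point with homogeneous coordinates \<open>z\<close>.\<close>
      let ?P = "vanishing_ideal (vec.span {z})"
      have "vec.span {z} \<subseteq> annihilator V"
        using z by (intro vec.span_minimal subspace_annihilator) auto
      then have "L' \<subseteq> ?P" unfolding L'_eq span_linear_forms[OF V(1)] vanishing_ideal_def by blast
      moreover have "X w \<notin> ?P" using w vec.span_base[of z "{z}"] by auto
      moreover have "homogeneous_prime ?P" by (rule homogeneous_prime_vanishing_ideal) simp
      ultimately have P: "?P \<in> points L'" by (auto simp: points_def simp del: in_vanishing_ideal)
      have "G \<in> ?P"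
        using z by (auto simp: vec.span_singleton eval_homogeneous[OF G])
      then have "?P \<in> points Y"
        using point_on_zero_scheme_iff_form_vanishes[OF zs _ gG] P Y' unfolding L'_eq by blast
      with P eq have "L \<subseteq> ?P" unfolding points_def by blast
      then have "linear_form c \<in> ?P" unfolding L_eq using ideal.span_superset by blast
      then show ?thesis using vec.span_base[of z "{z}"] by auto
    qed (simp add: dot_simps)
    then have "G \<in> ?Z"
      unfolding L'_eq by (rule form_without_zeros_off_hyperplane[OF V(1) c G])
    obtain v where v: "X v \<notin> L" using plane_in_own_points[OF L] by (auto simp: points_def)
    with \<open>L' \<subseteq> L\<close> have "X v \<notin> L'" by blast
    with gG have "g v - X v ^ N * G \<in> ?Z" using \<open>L' \<subseteq> ?Z\<close> unfolding L'_eq by blast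
    then have "g v \<in> ?Z"
      using \<open>G \<in> ?Z\<close> ideal_congD[OF ideal.subspace_span] ideal.span_scale by blast
    then have span: "ideal.span (insert (g v) Y') \<subseteq> ?Z"
      using Y' \<open>L' \<subseteq> ?Z\<close> by (intro ideal.span_minimal) auto
    show ?thesis
    proof
      fix y assume "y \<in> Y"
      then have "y \<in> on_chart (X v) (ideal.span (insert (g v) Y'))"
        using zs on_chart_self unfolding is_zero_scheme_def by blast
      then obtain M where "X v ^ M * y \<in> ?Z" using span unfolding on_chart_def by blast
      then obtain k where "X v ^ M * y - k * linear_form c ^ t \<in> L'"
        unfolding L'_eq in_span_insert_iff[OF ideal.subspace_span] by blast
      from ideal.subspace_neg[OF _ this]
      have "linear_form c ^ t * k - X v ^ M * y \<in> L'"
        unfolding L'_eq by (simp add: mult.commute)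
      \<comment> \<open>The coordinate \<open>X v\<close> is not a zero divisor on the fat plane, as it does not vanish on the support.\<close>
      moreover have "X v ^ M \<notin> L"
        using v homogeneous_prime_power plane_in_own_points[OF L] by (auto simp: points_def)
      ultimately show "y \<in> ?Z"
        using cancel_modulo_plane[OF V(1) c] unfolding L_eq L'_eq by blast
    qed
  qed
  then show ?thesis
    using L L' L_eq unfolding fat_plane_with_support_def contained_in_def by blast
qed

text \<open>
  The equations of \<open>Y'\<close> vanish on the fat plane and have degree less than \<open>t\<close>, so they vanish on the whole
  of \<open>L'\<close>. Hence the section restricts to \<open>L'\<close> as a form \<open>G\<close> of degree \<open>t\<close>. As it vanishes on the
  fat plane, it is divisible by the \<open>t\<close>-th power of the equation of \<open>L\<close>, so it is a constant multiple of
  this power: \<open>L'\<close> meets \<open>Y\<close> in \<open>L\<close>, or lies in \<open>Y\<close> if the constant is zero.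
\<close>

lemma support_of_fat_plane_strong:
  fixes Y' Y :: "('v::finite, 'k::field_char_0) mpoly set"
  assumes t: "t \<ge> 1" and "Y' \<subseteq> Y"
    and sect: "is_section Y' t N g" and zs: "is_zero_scheme Y' g Y"
    and deg: "set_theoretically_defined_in_degree_less t Y'"
    and fat: "fat_plane_with_support t r Z L" and "Y \<subseteq> Z"
  shows "strong_plane r Y' Y L"
proof -
  obtain L' c where L: "plane r L" and L': "plane (r + 1) L'"
    and L_eq: "L = ideal.span (insert (linear_form c) L')"
    and Z_eq: "Z = ideal.span (insert (linear_form c ^ t) L')"
    using fat by (auto simp: fat_plane_with_support_def)
  obtain V :: "('k^'v) set" where V: "vec.subspace V" "vec.dim V + (r + 2) = CARD('v)"
    and L'_eq: "L' = ideal.span (linear_form ` V)"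
    using L' by (auto simp: plane_def)
  have prime: "homogeneous_prime L'" and primeL: "homogeneous_prime L"
    using plane_in_own_points[OF L] plane_in_own_points[OF L'] by (auto simp: points_def)
  note I' = homogeneous_prime_ideal[OF prime] and I = homogeneous_prime_ideal[OF primeL]
  have "L' \<subseteq> L" and "L' \<subseteq> Z" and cL: "linear_form c \<in> L"
    unfolding L_eq Z_eq using ideal.span_superset by blast+
  have c: "c \<notin> V"
  proof
    assume "c \<in> V"
    then have "linear_form c \<in> L'" unfolding L'_eq by (intro ideal.span_base imageI)
    then have "L = L'"
      unfolding L_eq insert_absorb[OF \<open>linear_form c \<in> L'\<close>] by (simp only: ideal.span_eq_iff[THEN iffD2, OF I'])
    then obtain d where "d \<notin> V" "L' = ideal.span (insert (linear_form d) L')"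
      using plane_contained_in_plane[OF L V L'_eq] by blast
    then have "linear_form d \<in> L'" using ideal.span_base[of "linear_form d" "insert (linear_form d) L'"] by simp
    with \<open>d \<notin> V\<close> show False by (simp add: L'_eq linear_form_in_span_iff[OF V(1)])
  qed
  have "linear_form c ^ t \<in> L"
    using cL t ideal.subspace_scale[OF I cL, of "linear_form c ^ (t - 1)"]
    by (simp add: power_eq_if mult.commute)
  then have "Z \<subseteq> L"
    unfolding Z_eq using \<open>L' \<subseteq> L\<close> by (intro ideal.span_minimal I) auto
  with \<open>Y \<subseteq> Z\<close> have "Y \<subseteq> L" by blast
  obtain F where F: "F \<subseteq> Y'" "\<forall>f\<in>F. \<exists>d<t. homogeneous d f" "points F = points Y'"
    using deg by (auto simp: set_theoretically_defined_in_degree_less_def)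
  have "F \<subseteq> L'"
  proof
    fix f assume "f \<in> F"
    then obtain d where d: "d < t" "homogeneous d f" using F(2) by blast
    have "f \<in> Z" using \<open>f \<in> F\<close> F(1) \<open>Y' \<subseteq> Y\<close> \<open>Y \<subseteq> Z\<close> by blast
    then obtain k where "f - linear_form c ^ t * k \<in> L'"
      unfolding Z_eq in_span_insert_iff[OF I'] by (auto simp: mult.commute)
    then show "f \<in> L'"
      using factor_homogeneous[OF subspace_annihilator d(2) homogeneous_power_linear_form] d(1)
      unfolding L'_eq span_linear_forms[OF V(1)] by presburger
  qed
  then have "L' \<in> points Y'"
    using plane_in_own_points[OF L'] F(3) unfolding points_def by blast
  then have Y': "Y' \<subseteq> L'" by (simp add: points_def)
  obtain G where G: "homogeneous t G"
    and gG: "\<forall>w. X w \<notin> ideal.span (linear_form ` V) \<longrightarrow>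
      g w - X w ^ N * G \<in> ideal.span (linear_form ` V)"
    using section_on_plane_is_form[OF V(1) _ _ sect] V(2) Y' unfolding L'_eq by auto
  note on_Y = point_on_zero_scheme_iff_form_vanishes[OF zs Y'[unfolded L'_eq] gG, folded L'_eq]
  obtain v where v: "X v \<notin> L" using plane_in_own_points[OF L] by (auto simp: points_def)
  have "G \<in> Z"
  proof -
    have "X v \<notin> L'" using v \<open>L' \<subseteq> L\<close> by blast
    have "on_chart (X v) Y = on_chart (X v) (ideal.span (insert (g v) Y'))"
      using zs by (simp add: is_zero_scheme_def)
    then have "g v \<in> on_chart (X v) Y" by (simp add: on_chart_self ideal.span_base)
    then obtain M where "X v ^ M * g v \<in> Z" using \<open>Y \<subseteq> Z\<close> unfolding on_chart_def by blast
    then obtain k where k: "X v ^ M * g v - k * linear_form c ^ t \<in> L'"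
      unfolding Z_eq in_span_insert_iff[OF I'] by blast
    have gv: "g v - X v ^ N * G \<in> L'" using gG \<open>X v \<notin> L'\<close> unfolding L'_eq by blast
    have "linear_form c ^ t * k - X v ^ (M + N) * G =
        X v ^ M * (g v - X v ^ N * G) - (X v ^ M * g v - k * linear_form c ^ t)"
      by (simp add: algebra_simps power_add)
    also have "\<dots> \<in> L'"
      by (intro ideal.subspace_diff ideal.subspace_scale I' k gv)
    finally have "linear_form c ^ t * k - X v ^ (M + N) * G \<in> L'" .
    moreover have "X v ^ (M + N) \<notin> L" using v homogeneous_prime_power[OF primeL] by blast
    ultimately show ?thesis
      using cancel_modulo_plane[OF V(1) c] unfolding L_eq L'_eq Z_eq by blast
  qed
  then obtain k where k: "G - linear_form c ^ t * k \<in> L'"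
    unfolding Z_eq in_span_insert_iff[OF I'] by (auto simp: mult.commute)
  have "G - linear_form c ^ t * component 0 k \<in> L'"
    using factor_homogeneous[OF subspace_annihilator G homogeneous_power_linear_form
        k[unfolded L'_eq span_linear_forms[OF V(1)]]]
    unfolding L'_eq span_linear_forms[OF V(1)] by (simp del: in_vanishing_ideal)
  moreover obtain a where "component 0 k = Poly_Mapping.single 0 a"
  proof
    \<comment> \<open>Scaling by zero shows that a form of degree zero takes its value at the origin everywhere.\<close>
    show "component 0 k = Poly_Mapping.single 0 (eval (component 0 k) 0)"
      by (rule eval_ext) (use eval_homogeneous[OF homogeneous_component[of 0 k], of 0, symmetric] in simp)
  qed
  ultimately have a: "G - linear_form c ^ t * Poly_Mapping.single 0 a \<in> L'" by simp
  have "points L' \<inter> points Y = points L \<or> points L' \<inter> points Y = points L'"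
  proof (cases "a = 0")
    case True
    with a have "G \<in> L'" by simp
    then have "points L' \<subseteq> points Y" using on_Y unfolding points_def by blast
    then show ?thesis by blast
  next
    case False
    have "points L \<subseteq> points L' \<inter> points Y"
      using \<open>L' \<subseteq> L\<close> \<open>Y \<subseteq> L\<close> unfolding points_def by blast
    moreover have "P \<in> points L" if P: "P \<in> points L'" "P \<in> points Y" for P
    proof -
      have primeP: "homogeneous_prime P" and "L' \<subseteq> P" using P by (auto simp: points_def)
      note IP = homogeneous_prime_ideal[OF primeP]
      have "G \<in> P" using on_Y P by blast
      then have "linear_form c ^ t * Poly_Mapping.single 0 a \<in> P"
        using ideal_congD[OF IP] a \<open>L' \<subseteq> P\<close> by blast
      moreover have "Poly_Mapping.single 0 a \<notin> P"
      proof
        assume "Poly_Mapping.single 0 a \<in> P"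
        from ideal.subspace_scale[OF IP this, of "Poly_Mapping.single 0 (1 / a)"]
        have "1 \<in> P" using False by (simp add: mult_single)
        then show False using homogeneous_prime_one[OF primeP] by blast
      qed
      ultimately have "linear_form c \<in> P"
        using homogeneous_prime_mult[OF primeP] homogeneous_prime_power[OF primeP] by blast
      then have "L \<subseteq> P" unfolding L_eq using \<open>L' \<subseteq> P\<close> by (intro ideal.span_minimal IP) auto
      then show ?thesis using P by (auto simp: points_def)
    qed
    ultimately show ?thesis by blast
  qed
  then show ?thesis
    using L L' Y' \<open>Y \<subseteq> L\<close> \<open>L' \<subseteq> L\<close> unfolding strong_plane_def contained_in_def by blast
qed

theorem proposition1p2:
  fixes Y' Y :: "('v::finite, 'k::{alg_closed_field, field_char_0}) mpoly set"
    and r t :: nat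
  assumes "closed_subscheme Y'"
    and "t \<ge> 1"
    and "cartier_divisor Y' Y"
    and "Y \<in> linear_system Y' t"
  shows "(\<forall>L. strong_plane r Y' Y L \<longrightarrow>
            (\<exists>Z. fat_plane_with_support t r Z L \<and> contained_in Z Y)) \<and>
         (set_theoretically_defined_in_degree_less t Y' \<longrightarrow>
            (\<forall>Z L. fat_plane_with_support t r Z L \<and> contained_in Z Y \<longrightarrow>
               strong_plane r Y' Y L))"
proof -
  obtain N g where sect: "is_section Y' t N g" "is_zero_scheme Y' g Y"
    using assms(4) by (auto simp: linear_system_def)
  have "Y' \<subseteq> Y" using assms(3) by (simp add: cartier_divisor_def contained_in_def)
  then show ?thesis
    using strong_plane_supports_fat_plane[OF sect] support_of_fat_plane_strong[OF assms(2) _ sect]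
    unfolding contained_in_def by blast
qed

end
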